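(* Let $a<b$ be real numbers. Assume that $g:[a,b]\to\mathbb{R}$ is differentiable (with finite derivative) almost everywhere on $[a,b]$ and that $f:\mathbb{R}\to\mathbb{R}$ is HK integrable on every closed interval with endpoints in the range of $g$. Define $F(x):=(HK)\int_{g(a)}^{x}f(u)\,du$ (for $x$ in the smallest interval containing the range of $g$). Let $B\subseteq[a,b]$ be the set of points where the equality $(F\circ g)'=(f\circ g)\cdot g'$ fails. Then the following are equivalent: (i) $(f\circ g)\cdot g'$ is HK integrable on $[a,b]$ and $$(HK)\int_{g(\alpha)}^{g(\beta)}f(u)\,du=(HK)\int_{\alpha}^{\beta}f(g(s))\,g'(s)\,ds$$ holds for every $[\alpha,\beta]\subseteq[a,b]$; (ii) $F\circ g$ has negligible variation on $B$.
   Context: Derivatives are finite derivatives; at the endpoints of $[a,b]$ they are one-sided. The equality $(F\circ g)'(x)=f(g(x))g'(x)$ is said to fail at $x\in[a,b]$ if it is false at $x$ or if either side is undefined at $x$ (in particular if $F\circ g$ is not differentiable at $x$ or $g'(x)$ does not exist). A tagged partition of $[a,b]$ is a finite set $P=\{(x_j,I_j):1\le j\le n\}$ with closed intervals $I_j=[a_j,b_j]$, $x_j\in I_j$, $\bigcup_j I_j=[a,b]$, and $(a_i,b_i)\cap(a_j,b_j)=\emptyset$ for $i\ne j$. A gauge on $[a,b]$ is a function $\delta:[a,b]\to(0,\infty)$. $P$ is subordinate to $\delta$ if $I_j\subseteq(x_j-\delta(x_j),x_j+\delta(x_j))$ for every $j$. A function $\phi:[a,b]\to\mathbb{R}$ is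 HK (Henstock–Kurzweil) integrable over $[a,b]$ with integral $(HK)\int_a^b\phi(x)\,dx=A$ if for every $\epsilon>0$ there is a gauge $\delta$ on $[a,b]$ such that every tagged partition $P$ of $[a,b]$ subordinate to $\delta$ satisfies $\left|\sum_{j}\phi(x_j)(b_j-a_j)-A\right|<\epsilon$. One sets $(HK)\int_b^a\phi=-(HK)\int_a^b\phi$; the integral over a degenerate interval is $0$. If $\phi$ is only defined almost everywhere, its HK integral means that of the function equal to $\phi$ where $\phi$ is defined and $0$ elsewhere. A function $\phi:[a,b]\to\mathbb{R}$ has negligible variation on a set $E\subseteq[a,b]$ if for every $\epsilon>0$ there is a gauge $\delta$ on $[a,b]$ such that for every tagged partition $\{(x_j,[a_j,b_j]):1\le j\le n\}$ of $[a,b]$ subordinate to $\delta$, $\sum_{x_j\in E}|\phi(b_j)-\phi(a_j)|<\epsilon$. *)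

theory Defs
  imports "HOL-Analysis.Analysis"
begin

(* Henstock--Kurzweil integrals over closed intervals are the library's integrable_on and
   integral: on {a..b} these are gauge integrals over tagged divisions. *)

definition hk_integral :: "real \<Rightarrow> real \<Rightarrow> (real \<Rightarrow> real) \<Rightarrow> real" where
  "hk_integral u v \<phi> = (if u \<le> v then integral {u..v} \<phi> else - integral {v..u} \<phi>)"

(* Functions on [a,b] are total functions on the reals; only their values on {a..b} matter,
   and "at x within {a..b}" yields one-sided derivatives at the endpoints. *)

definition chain_rule_holds_at ::
    "real \<Rightarrow> real \<Rightarrow> (real \<Rightarrow> real) \<Rightarrow> (real \<Rightarrow> real) \<Rightarrow> (real \<Rightarrow> real) \<Rightarrow> real \<Rightarrow> bool" where
  "chain_rule_holds_at a b F f g x \<longleftrightarrow>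
     (\<exists>D d. ((F \<circ> g) has_real_derivative D) (at x within {a..b}) \<and>
            (g has_real_derivative d) (at x within {a..b}) \<and>
            D = f (g x) * d)"

(* The a.e. defined function (f o g) g', extended by 0 where g' does not exist. *)

definition substituted_integrand ::
    "real \<Rightarrow> real \<Rightarrow> (real \<Rightarrow> real) \<Rightarrow> (real \<Rightarrow> real) \<Rightarrow> real \<Rightarrow> real" where
  "substituted_integrand a b f g s =
     (if g differentiable (at s within {a..b})
      then f (g s) * vector_derivative g (at s within {a..b}) else 0)"

(* ball x (\<delta> x) is the open interval (x - \<delta> x, x + \<delta> x); a cell K = [c,d] of a tagged
   division is nonempty, so c = Inf K and d = Sup K. *)

definition negligible_variation_on ::
    "real \<Rightarrow> real \<Rightarrow> (real \<Rightarrow> real) \<Rightarrow> real set \<Rightarrow> bool" where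
  "negligible_variation_on a b \<phi> E \<longleftrightarrow>
     (\<forall>\<epsilon>>0. \<exists>\<delta>. (\<forall>x\<in>{a..b}. 0 < \<delta> x) \<and>
        (\<forall>P. P tagged_division_of {a..b} \<and> (\<lambda>x. ball x (\<delta> x)) fine P \<longrightarrow>
           (\<Sum>(x, K)\<in>{(x, K)\<in>P. x \<in> E}. \<bar>\<phi> (Sup K) - \<phi> (Inf K)\<bar>) < \<epsilon>))"

end

theory Submission
  imports Defs
begin

text \<open>
  Write \<open>G = F \<circ> g\<close> and let \<open>h\<close> be the integrand \<open>(f \<circ> g) \<cdot> g'\<close>, extended by \<open>0\<close> to the points where
  \<open>g'\<close> does not exist. Since HK integrals are additive over adjacent intervals, the integral of \<open>f\<close>
  from \<open>g u\<close> to \<open>g v\<close> is \<open>G v - G u\<close>, so the substitution formula says exactly that \<open>G\<close> is an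
  indefinite HK integral of \<open>h\<close> on \<open>{a..b}\<close>.

  The first idea is that \<open>h\<close> vanishes almost everywhere on the exceptional set \<open>B\<close>, whether or not
  \<open>B\<close> itself is null (\<open>negligible_chain_rule_fails_at_nonzero_integrand\<close>). An indefinite HK
  integral is differentiable almost everywhere, so \<open>F' = f\<close> on the range of \<open>g\<close> outside a null set
  \<open>N\<close>. The points where \<open>g'\<close> exists and is not \<open>0\<close> fall into countably many pieces on each of
  which \<open>g\<close> has a Lipschitz inverse, so those of them that \<open>g\<close> maps into \<open>N\<close> form a null set. At all other points with \<open>g'\<close>
  nonzero the ordinary chain rule applies. Replacing \<open>h\<close> by \<open>0\<close> on \<open>B\<close> therefore changes none of
  its integrals; call the result \<open>k\<close>.

  It remains to compare \<open>G\<close> with \<open>k\<close>: here \<open>G' = k\<close> off \<open>B\<close> and \<open>k = 0\<close> on \<open>B\<close>, and under these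
  two conditions \<open>G\<close> is an indefinite integral of \<open>k\<close> if and only if \<open>G\<close> has negligible variation
  on \<open>B\<close> (\<open>negligible_variation_iff_indefinite_integral\<close>). Given negligible variation, a Riemann
  sum of \<open>k\<close> splits into the cells tagged off \<open>B\<close>, where the derivative makes
  \<open>k x * (v - u) - (G v - G u)\<close> small relative to \<open>v - u\<close>, and the cells tagged in \<open>B\<close>, which
  contribute nothing to the Riemann sum and little to the increment of \<open>G\<close>. Conversely, Henstock's
  lemma bounds the sum of \<open>\<bar>k x * (v - u) - (G v - G u)\<bar>\<close> over any subfamily of cells; for the
  cells tagged in \<open>B\<close> this sum is the variation of \<open>G\<close>.
\<close>

section \<open>Negligible variation and indefinite integrals\<close>

lemma tagged_cell_real:
  fixes a b :: real
  assumes "P tagged_division_of {a..b}" "(x, K) \<in> P"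
  obtains u v where "K = {u..v}" "u \<le> x" "x \<le> v" "a \<le> u" "v \<le> b"
proof -
  from tagged_division_ofD(4)[OF assms] obtain u v where K: "K = {u..v}" by auto
  moreover have "x \<in> K" "K \<subseteq> {a..b}" using tagged_division_ofD(2,3)[OF assms] by auto
  ultimately show thesis by (intro that[of u v]) auto
qed

text \<open>
  The straddle lemma: the linear approximation at \<open>x\<close> controls increments over intervals that contain
  \<open>x\<close>, because the errors of the two parts \<open>[u, x]\<close> and \<open>[x, v]\<close> add up to a multiple of \<open>v - u\<close>.
\<close>

lemma has_real_derivative_straddle:
  fixes \<phi> :: "real \<Rightarrow> real"
  assumes "(\<phi> has_real_derivative D) (at x within S)" "e > 0"
  obtains d where "d > 0"
    "\<And>u v. \<lbrakk>u \<in> S; v \<in> S; u \<le> x; x \<le> v; {u..v} \<subseteq> ball x d\<rbrakk> \<Longrightarrow>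
       \<bar>D * (v - u) - (\<phi> v - \<phi> u)\<bar> \<le> e * (v - u)"
proof -
  from assms obtain d where "d > 0" and
    d: "\<And>y. y \<in> S \<Longrightarrow> \<bar>y - x\<bar> < d \<Longrightarrow> \<bar>\<phi> y - \<phi> x - D * (y - x)\<bar> \<le> e * \<bar>y - x\<bar>"
    unfolding has_field_derivative_def has_derivative_within_alt real_norm_def by meson
  show thesis
  proof (rule that[OF \<open>d > 0\<close>])
    fix u v assume uv: "u \<in> S" "v \<in> S" "u \<le> x" "x \<le> v" "{u..v} \<subseteq> ball x d"
    then have "u \<in> ball x d" "v \<in> ball x d"
      using subsetD[OF uv(5), of u] subsetD[OF uv(5), of v] by simp_all
    then have "\<bar>\<phi> u - \<phi> x - D * (u - x)\<bar> \<le> e * (x - u)" "\<bar>\<phi> v - \<phi> x - D * (v - x)\<bar> \<le> e * (v - x)"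
      using d[of u] d[of v] uv by (auto simp: dist_real_def)
    moreover have "D * (v - u) - (\<phi> v - \<phi> u)
        = (\<phi> u - \<phi> x - D * (u - x)) - (\<phi> v - \<phi> x - D * (v - x))" by (simp add: algebra_simps)
    ultimately show "\<bar>D * (v - u) - (\<phi> v - \<phi> u)\<bar> \<le> e * (v - u)"
      by (simp add: right_diff_distrib)
  qed
qed

text \<open>
  A fundamental theorem of calculus with an exceptional set that may have positive measure. The gauge
  is the smaller of the one that makes the variation over cells tagged in \<open>E\<close> small and the one from
  the straddle lemma off \<open>E\<close>.
\<close>

lemma has_integral_if_negligible_variation:
  fixes \<phi> k :: "real \<Rightarrow> real"
  assumes "a \<le> b"
    and deriv: "\<And>x. x \<in> {a..b} - E \<Longrightarrow> (\<phi> has_real_derivative k x) (at x within {a..b})"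
    and zero: "\<And>x. x \<in> E \<Longrightarrow> k x = 0"
    and negl: "negligible_variation_on a b \<phi> E"
  shows "(k has_integral (\<phi> b - \<phi> a)) {a..b}"
  unfolding has_integral_real
proof (intro allI impI)
  fix e :: real assume "e > 0"
  \<comment> \<open>The summand 1 keeps the denominator positive when the interval is degenerate.\<close>
  define \<eta> where "\<eta> = e / 2 / (b - a + 1)"
  have "\<eta> > 0" using \<open>e > 0\<close> \<open>a \<le> b\<close> by (simp add: \<eta>_def)
  have "e / 2 > 0" using \<open>e > 0\<close> by simp
  with negl
  obtain \<delta>1 where \<delta>1: "\<And>x. x \<in> {a..b} \<Longrightarrow> 0 < \<delta>1 x"
    and var: "\<And>P. P tagged_division_of {a..b} \<Longrightarrow> (\<lambda>x. ball x (\<delta>1 x)) fine P \<Longrightarrow>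
           (\<Sum>(x, K)\<in>{(x, K)\<in>P. x \<in> E}. \<bar>\<phi> (Sup K) - \<phi> (Inf K)\<bar>) < e / 2"
    unfolding negligible_variation_on_def by fast
  have "\<forall>x\<in>{a..b} - E. \<exists>d>0. \<forall>u\<in>{a..b}. \<forall>v\<in>{a..b}. u \<le> x \<longrightarrow> x \<le> v \<longrightarrow> {u..v} \<subseteq> ball x d \<longrightarrow>
       \<bar>k x * (v - u) - (\<phi> v - \<phi> u)\<bar> \<le> \<eta> * (v - u)"
    using has_real_derivative_straddle[OF deriv \<open>\<eta> > 0\<close>] by (metis (full_types))
  then obtain \<delta>2 where \<delta>2: "\<And>x. x \<in> {a..b} - E \<Longrightarrow> 0 < \<delta>2 x"
    and straddle: "\<And>x u v. \<lbrakk>x \<in> {a..b} - E; u \<in> {a..b}; v \<in> {a..b}; u \<le> x; x \<le> v; {u..v} \<subseteq> ball x (\<delta>2 x)\<rbrakk> \<Longrightarrow>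
       \<bar>k x * (v - u) - (\<phi> v - \<phi> u)\<bar> \<le> \<eta> * (v - u)"
    by metis
  define \<delta> where "\<delta> x = (if x \<in> {a..b} then if x \<in> E then \<delta>1 x else min (\<delta>1 x) (\<delta>2 x) else 1)" for x
  have "\<forall>x. 0 < \<delta> x" using \<delta>1 \<delta>2 by (auto simp: \<delta>_def)
  then have gauge: "gauge (\<lambda>x. ball x (\<delta> x))" by (rule gauge_ball_dependent)
  moreover have "norm ((\<Sum>(x, K)\<in>P. measure lborel K *\<^sub>R k x) - (\<phi> b - \<phi> a)) < e"
    if P: "P tagged_division_of {a..b}" and fine: "(\<lambda>x. ball x (\<delta> x)) fine P" for P
  proof -
    have fin: "finite P" using P by auto
    have fine1: "(\<lambda>x. ball x (\<delta>1 x)) fine P"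
    proof (rule fineI)
      fix x K assume xK: "(x, K) \<in> P"
      then have "K \<subseteq> ball x (\<delta> x)" using fine by blast
      moreover have "\<delta> x \<le> \<delta>1 x" using tag_in_interval[OF P xK] by (auto simp: \<delta>_def)
      ultimately show "K \<subseteq> ball x (\<delta>1 x)" by (meson order_trans subset_ball)
    qed
    have cell: "\<bar>measure lborel K * k x - (\<phi> (Sup K) - \<phi> (Inf K))\<bar>
        \<le> (if x \<in> E then \<bar>\<phi> (Sup K) - \<phi> (Inf K)\<bar> else 0) + \<eta> * measure lborel K" if "(x, K) \<in> P" for x K
    proof (cases "x \<in> E")
      case True
      then show ?thesis using zero \<open>\<eta> > 0\<close> by (simp add: abs_minus_commute)
    next
      case False
      from tagged_cell_real[OF P \<open>(x, K) \<in> P\<close>] obtain u v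
        where K: "K = {u..v}" "u \<le> x" "x \<le> v" "a \<le> u" "v \<le> b" .
      have "K \<subseteq> ball x (\<delta> x)" using fine \<open>(x, K) \<in> P\<close> by blast
      moreover have "\<delta> x \<le> \<delta>2 x" using K False by (auto simp: \<delta>_def)
      ultimately have "{u..v} \<subseteq> ball x (\<delta>2 x)" using K by (meson order_trans subset_ball)
      then show ?thesis using straddle[of x u v] K False by (simp add: mult.commute)
    qed
    have "(\<Sum>(x, K)\<in>P. measure lborel K *\<^sub>R k x) - (\<phi> b - \<phi> a)
        = (\<Sum>(x, K)\<in>P. measure lborel K * k x - (\<phi> (Sup K) - \<phi> (Inf K)))"
      using additive_tagged_division_1[OF \<open>a \<le> b\<close> P, of \<phi>]
      by (simp add: split_def sum_subtractf)
    also have "\<bar>\<dots>\<bar> \<le> (\<Sum>(x, K)\<in>P. \<bar>measure lborel K * k x - (\<phi> (Sup K) - \<phi> (Inf K))\<bar>)"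
      using sum_abs by (simp add: split_def)
    also have "\<dots> \<le> (\<Sum>(x, K)\<in>P. (if x \<in> E then \<bar>\<phi> (Sup K) - \<phi> (Inf K)\<bar> else 0) + \<eta> * measure lborel K)"
      using cell by (intro sum_mono) auto
    also have "\<dots> = (\<Sum>(x, K)\<in>P. if x \<in> E then \<bar>\<phi> (Sup K) - \<phi> (Inf K)\<bar> else 0) + \<eta> * (\<Sum>(x, K)\<in>P. measure lborel K)"
      by (simp add: split_def sum.distrib sum_distrib_left)
    also have "(\<Sum>(x, K)\<in>P. if x \<in> E then \<bar>\<phi> (Sup K) - \<phi> (Inf K)\<bar> else 0)
        = (\<Sum>(x, K)\<in>{(x, K)\<in>P. x \<in> E}. \<bar>\<phi> (Sup K) - \<phi> (Inf K)\<bar>)"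
      using fin by (simp add: split_def sum.inter_filter)
    also have "(\<Sum>(x, K)\<in>P. measure lborel K) = b - a"
      using additive_content_tagged_division[of P a b] P \<open>a \<le> b\<close> by simp
    also have "(\<Sum>(x, K)\<in>{(x, K)\<in>P. x \<in> E}. \<bar>\<phi> (Sup K) - \<phi> (Inf K)\<bar>) + \<eta> * (b - a) < e"
    proof -
      have "\<eta> * (b - a) \<le> e / 2"
        using \<open>e > 0\<close> \<open>a \<le> b\<close> by (simp add: \<eta>_def field_simps)
      then show ?thesis using var[OF P fine1] by linarith
    qed
    finally show ?thesis by simp
  qed
  ultimately show "\<exists>\<gamma>. gauge \<gamma> \<and> (\<forall>P. P tagged_division_of {a..b} \<and> \<gamma> fine P \<longrightarrow>
      norm ((\<Sum>(x, K)\<in>P. measure lborel K *\<^sub>R k x) - (\<phi> b - \<phi> a)) < e)"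
    by (intro exI[of _ "\<lambda>x. ball x (\<delta> x)"]) simp
qed

text \<open>
  Cousin's lemma extends a fine division of the smaller interval to a fine division of the larger one,
  and the added cells only increase the sum of absolute increments.
\<close>

lemma negligible_variation_on_subinterval:
  assumes negl: "negligible_variation_on a b \<phi> E" and "a \<le> \<alpha>" "\<alpha> \<le> \<beta>" "\<beta> \<le> b"
  shows "negligible_variation_on \<alpha> \<beta> \<phi> E"
  unfolding negligible_variation_on_def
proof (intro allI impI)
  fix \<epsilon> :: real assume "\<epsilon> > 0"
  with negl
  obtain \<delta> where \<delta>: "\<And>x. x \<in> {a..b} \<Longrightarrow> 0 < \<delta> x"
    and var: "\<And>P. P tagged_division_of {a..b} \<Longrightarrow> (\<lambda>x. ball x (\<delta> x)) fine P \<Longrightarrow>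
           (\<Sum>(x, K)\<in>{(x, K)\<in>P. x \<in> E}. \<bar>\<phi> (Sup K) - \<phi> (Inf K)\<bar>) < \<epsilon>"
    unfolding negligible_variation_on_def by fast
  define \<gamma> where "\<gamma> = (\<lambda>x. ball x (if x \<in> {a..b} then \<delta> x else 1))"
  have "gauge \<gamma>" unfolding \<gamma>_def using \<delta> by (intro gauge_ball_dependent) auto
  then obtain P1 P2 where P1: "P1 tagged_division_of {a..\<alpha>}" "\<gamma> fine P1"
    and P2: "P2 tagged_division_of {\<beta>..b}" "\<gamma> fine P2"
    by (metis fine_division_exists_real)
  have "(\<Sum>(x, K)\<in>{(x, K)\<in>P. x \<in> E}. \<bar>\<phi> (Sup K) - \<phi> (Inf K)\<bar>) < \<epsilon>"
    if P: "P tagged_division_of {\<alpha>..\<beta>}" "(\<lambda>x. ball x (\<delta> x)) fine P" for P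
  proof -
    let ?Q = "P1 \<union> P \<union> P2"
    have "?Q tagged_division_of ({a..\<alpha>} \<union> {\<alpha>..\<beta>} \<union> {\<beta>..b})"
      using assms by (intro tagged_division_Un P1 P P2) (auto simp: ivl_disj_un)
    moreover have "{a..\<alpha>} \<union> {\<alpha>..\<beta>} \<union> {\<beta>..b} = {a..b}" using assms by auto
    ultimately have Q: "?Q tagged_division_of {a..b}" by simp
    have "(\<lambda>x. ball x (\<delta> x)) fine p" if "\<gamma> fine p" "p \<subseteq> ?Q" for p
    proof (rule fineI)
      fix x K assume "(x, K) \<in> p"
      then have "K \<subseteq> \<gamma> x" "x \<in> {a..b}"
        using that tag_in_interval[OF Q] by (blast dest: fineD)+
      then show "K \<subseteq> ball x (\<delta> x)" by (simp add: \<gamma>_def)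
    qed
    then have "(\<lambda>x. ball x (\<delta> x)) fine ?Q" using P P1(2) P2(2) by (intro fine_Un) auto
    note var[OF Q this]
    moreover have "(\<Sum>(x, K)\<in>{(x, K)\<in>P. x \<in> E}. \<bar>\<phi> (Sup K) - \<phi> (Inf K)\<bar>)
        \<le> (\<Sum>(x, K)\<in>{(x, K)\<in>?Q. x \<in> E}. \<bar>\<phi> (Sup K) - \<phi> (Inf K)\<bar>)"
    proof (rule sum_mono2)
      show "finite {(x, K) \<in> ?Q. x \<in> E}"
        using Q by (auto intro: finite_subset[OF _ tagged_division_ofD(1)[OF Q]])
    qed auto
    ultimately show ?thesis by linarith
  qed
  then show "\<exists>\<delta>. (\<forall>x\<in>{\<alpha>..\<beta>}. 0 < \<delta> x) \<and>
      (\<forall>P. P tagged_division_of {\<alpha>..\<beta>} \<and> (\<lambda>x. ball x (\<delta> x)) fine P \<longrightarrow>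
         (\<Sum>(x, K)\<in>{(x, K)\<in>P. x \<in> E}. \<bar>\<phi> (Sup K) - \<phi> (Inf K)\<bar>) < \<epsilon>)"
    using \<delta> assms by (intro exI[of _ \<delta>]) auto
qed

text \<open>
  Henstock's lemma applies to the cells tagged in \<open>E\<close> alone, since they form a partial division. There
  \<open>k\<close> vanishes at the tags, so what it bounds is the sum of the absolute increments of \<open>\<phi>\<close>.
\<close>

lemma negligible_variation_on_indefinite_integral:
  fixes \<phi> k :: "real \<Rightarrow> real"
  assumes int: "k integrable_on {a..b}"
    and eq: "\<And>u v. \<lbrakk>a \<le> u; u \<le> v; v \<le> b\<rbrakk> \<Longrightarrow> \<phi> v - \<phi> u = integral {u..v} k"
    and zero: "\<And>x. x \<in> E \<Longrightarrow> k x = 0"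
  shows "negligible_variation_on a b \<phi> E"
  unfolding negligible_variation_on_def
proof (intro allI impI)
  fix \<epsilon> :: real assume "\<epsilon> > 0"
  then obtain \<gamma> where "gauge \<gamma>" and
    H: "\<And>p. p tagged_partial_division_of {a..b} \<Longrightarrow> \<gamma> fine p \<Longrightarrow>
             (\<Sum>(x, K)\<in>p. norm (measure lborel K *\<^sub>R k x - integral K k)) < \<epsilon>"
    by (rule Henstock_lemma[of k a b \<epsilon>, unfolded box_real, OF int]) (rule that)
  have "\<forall>x. \<exists>d>0. ball x d \<subseteq> \<gamma> x"
    using \<open>gauge \<gamma>\<close> by (meson gaugeD open_contains_ball)
  then obtain \<delta> where \<delta>: "\<And>x. 0 < \<delta> x" "\<And>x. ball x (\<delta> x) \<subseteq> \<gamma> x" by metis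
  have "(\<Sum>(x, K)\<in>{(x, K)\<in>P. x \<in> E}. \<bar>\<phi> (Sup K) - \<phi> (Inf K)\<bar>) < \<epsilon>"
    if P: "P tagged_division_of {a..b}" "(\<lambda>x. ball x (\<delta> x)) fine P" for P
  proof -
    let ?p = "{(x, K)\<in>P. x \<in> E}"
    have "?p tagged_partial_division_of {a..b}"
      using P by (auto intro: tagged_partial_division_subset simp: tagged_division_of_def)
    moreover have "\<gamma> fine ?p" using P \<delta>(2) unfolding fine_def by fastforce
    ultimately have "(\<Sum>(x, K)\<in>?p. norm (measure lborel K *\<^sub>R k x - integral K k)) < \<epsilon>" by (rule H)
    moreover have "\<bar>\<phi> (Sup K) - \<phi> (Inf K)\<bar> = norm (measure lborel K *\<^sub>R k x - integral K k)"
      if "(x, K) \<in> P" "x \<in> E" for x K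
    proof -
      from tagged_cell_real[OF P(1) that(1)] obtain u v
        where K: "K = {u..v}" "u \<le> x" "x \<le> v" "a \<le> u" "v \<le> b" .
      then show ?thesis using eq[of u v] zero[OF that(2)] by simp
    qed
    then have "(\<Sum>(x, K)\<in>?p. \<bar>\<phi> (Sup K) - \<phi> (Inf K)\<bar>)
        = (\<Sum>(x, K)\<in>?p. norm (measure lborel K *\<^sub>R k x - integral K k))"
      by (intro sum.cong) auto
    ultimately show ?thesis by simp
  qed
  then show "\<exists>\<delta>. (\<forall>x\<in>{a..b}. 0 < \<delta> x) \<and>
      (\<forall>P. P tagged_division_of {a..b} \<and> (\<lambda>x. ball x (\<delta> x)) fine P \<longrightarrow>
         (\<Sum>(x, K)\<in>{(x, K)\<in>P. x \<in> E}. \<bar>\<phi> (Sup K) - \<phi> (Inf K)\<bar>) < \<epsilon>)"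
    using \<delta> by (intro exI[of _ \<delta>]) auto
qed

lemma negligible_variation_iff_indefinite_integral:
  fixes \<phi> k :: "real \<Rightarrow> real"
  assumes deriv: "\<And>x. x \<in> {a..b} - E \<Longrightarrow> (\<phi> has_real_derivative k x) (at x within {a..b})"
    and zero: "\<And>x. x \<in> E \<Longrightarrow> k x = 0" and "a \<le> b"
  shows "negligible_variation_on a b \<phi> E \<longleftrightarrow>
    (\<forall>u v. a \<le> u \<and> u \<le> v \<and> v \<le> b \<longrightarrow> (k has_integral (\<phi> v - \<phi> u)) {u..v})"
    (is "_ \<longleftrightarrow> ?R")
proof
  assume negl: "negligible_variation_on a b \<phi> E"
  show ?R
  proof (intro allI impI, elim conjE)
    fix u v assume uv: "a \<le> u" "u \<le> v" "v \<le> b"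
    show "(k has_integral (\<phi> v - \<phi> u)) {u..v}"
      using uv negligible_variation_on_subinterval[OF negl uv] zero
      by (intro has_integral_if_negligible_variation)
         (auto intro: DERIV_subset[OF deriv])
  qed
next
  assume ?R
  then show "negligible_variation_on a b \<phi> E"
    using \<open>a \<le> b\<close> zero
    by (intro negligible_variation_on_indefinite_integral[where k = k]) (auto simp: has_integral_iff)
qed

section \<open>Almost everywhere differentiability of indefinite integrals\<close>

lemma hk_integral_eq_diff:
  assumes "f integrable_on {c..d}" "u \<in> {c..d}" "v \<in> {c..d}"
  shows "hk_integral u v f = integral {c..v} f - integral {c..u} f"
proof -
  have *: "integral {c..x} f + integral {x..y} f = integral {c..y} f" if "c \<le> x" "x \<le> y" "y \<le> d" for x y
    using that by (intro Henstock_Kurzweil_Integration.integral_combine integrable_subinterval_real[OF assms(1)]) auto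
  show ?thesis
    using *[of u v] *[of v u] assms by (auto simp: hk_integral_def)
qed

text \<open>
  Almost everywhere convergence of the averages over \<open>[x, x + h]\<close> gives the right derivative; the
  same for the reflected function \<open>x \<mapsto> f (- x)\<close> gives the left derivative.
\<close>

lemma negligible_hk_integral_not_DERIV:
  assumes int: "f integrable_on {c..d}" and z: "z \<in> {c..d}"
  shows "negligible {u \<in> {c<..<d}. \<not> ((\<lambda>x. hk_integral z x f) has_real_derivative f u) (at u)}"
proof -
  \<comment> \<open>The averages converge for functions integrable on every bounded interval, hence the
    extension by 0.\<close>
  define \<phi> where "\<phi> x = (if x \<in> {c..d} then f x else 0)" for x
  have int\<phi>: "\<phi> integrable_on {u..v}" for u v
    unfolding \<phi>_def integrable_restrict_Int Int_atLeastAtMost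
    using int by (rule integrable_subinterval_real) auto
  have int\<phi>': "(\<lambda>x. \<phi> (- x)) integrable_on {u..v}" for u v
    using int\<phi>[of "- v" "- u"] Henstock_Kurzweil_Integration.integrable_reflect_real[where f = \<phi> and a = "- v" and b = "- u"] by simp
  obtain N1 where "negligible N1" and N1:
    "\<And>x e. x \<notin> N1 \<Longrightarrow> 0 < e \<Longrightarrow> \<exists>r>0. \<forall>h. 0 < h \<and> h < r \<longrightarrow> \<bar>integral {x..x + h} \<phi> / h - \<phi> x\<bar> < e"
    using integrable_ccontinuous_explicit[where f = \<phi>] int\<phi> by (auto simp: divide_inverse mult.commute)
  obtain N2 where "negligible N2" and N2:
    "\<And>x e. x \<notin> N2 \<Longrightarrow> 0 < e \<Longrightarrow> \<exists>r>0. \<forall>h. 0 < h \<and> h < r \<longrightarrow> \<bar>integral {x..x + h} (\<lambda>x. \<phi> (- x)) / h - \<phi> (- x)\<bar> < e"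
    using integrable_ccontinuous_explicit[where f = "\<lambda>x. \<phi> (- x)"] int\<phi>' by (auto simp: divide_inverse mult.commute)
  have "negligible (uminus ` N2)"
    using \<open>negligible N2\<close> by (intro negligible_differentiable_image_negligible)
      (auto simp: differentiable_on_def intro!: derivative_intros)
  with \<open>negligible N1\<close> have null: "negligible (N1 \<union> uminus ` N2)" by (rule negligible_Un)
  have DERIV: "((\<lambda>x. hk_integral z x f) has_real_derivative f u) (at u)"
    if u: "c < u" "u < d" and "u \<notin> N1" "u \<notin> uminus ` N2" for u
    unfolding has_field_derivative_iff LIM_def
  proof (intro allI impI)
    fix e :: real assume "e > 0"
    obtain r1 where r1: "r1 > 0" "\<And>h. 0 < h \<Longrightarrow> h < r1 \<Longrightarrow> \<bar>integral {u..u + h} \<phi> / h - f u\<bar> < e"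
      using N1[OF \<open>u \<notin> N1\<close> \<open>e > 0\<close>] u by (auto simp: \<phi>_def)
    have "- u \<notin> N2" using \<open>u \<notin> uminus ` N2\<close> by (metis image_eqI minus_minus)
    then obtain r2 where r2: "r2 > 0" "\<And>h. 0 < h \<Longrightarrow> h < r2 \<Longrightarrow> \<bar>integral {- u..- u + h} (\<lambda>x. \<phi> (- x)) / h - f u\<bar> < e"
      using N2[of "- u" e] \<open>e > 0\<close> u by (auto simp: \<phi>_def)
    have \<phi>f: "integral {x..y} \<phi> = integral {x..y} f" if "c \<le> x" "y \<le> d" for x y
      using that by (intro integral_cong) (auto simp: \<phi>_def)
    define r where "r = min (min r1 r2) (min (u - c) (d - u))"
    have "\<bar>(hk_integral z y f - hk_integral z u f) / (y - u) - f u\<bar> < e" if "y \<noteq> u" "\<bar>y - u\<bar> < r" for y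
    proof -
      have y: "y \<in> {c..d}" using that u by (auto simp: r_def)
      have diff: "hk_integral z y f - hk_integral z u f = hk_integral u y f"
        using hk_integral_eq_diff[OF int] z y u by simp
      show ?thesis
      proof (cases "u < y")
        case True
        then show ?thesis using r1(2)[of "y - u"] that u y \<phi>f[of u y]
          unfolding diff by (simp add: hk_integral_def r_def)
      next
        case False
        then have "integral {- u..- u + (u - y)} (\<lambda>x. \<phi> (- x)) = integral {y..u} f"
          using integral_reflect_real[where f = \<phi> and a = y and b = u] u y \<phi>f[of y u] by simp
        then show ?thesis using r2(2)[of "u - y"] that u y False
          unfolding diff by (simp add: hk_integral_def r_def minus_divide_right)
      qed
    qed
    moreover have "r > 0" using r1 r2 u by (simp add: r_def)
    ultimately show "\<exists>r>0. \<forall>y. y \<noteq> u \<and> dist y u < r \<longrightarrow>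
        dist ((hk_integral z y f - hk_integral z u f) / (y - u)) (f u) < e"
      by (auto simp: dist_real_def)
  qed
  show ?thesis
    by (rule negligible_subset[OF null]) (use DERIV in \<open>simp add: subset_iff, blast\<close>)
qed

text \<open>
  The smallest interval containing \<open>R\<close> may be unbounded or fail to be closed, and \<open>f\<close> is only
  integrable on its compact parts. A point of \<open>R\<close> that is not extremal lies strictly between two
  others, hence inside one of countably many compact intervals with rational endpoints on which the
  previous lemma applies; the least and the greatest element of \<open>R\<close> are at most two further points.
\<close>

lemma negligible_hk_integral_not_DERIV_on:
  assumes int: "\<forall>s\<in>R. \<forall>t\<in>R. s \<le> t \<longrightarrow> f integrable_on {s..t}" and z: "z \<in> R"
  shows "negligible {u \<in> R. \<not> ((\<lambda>x. hk_integral z x f) has_real_derivative f u) (at u)}"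
    (is "negligible {u \<in> R. \<not> ?D u}")
proof -
  \<comment> \<open>Each rational interval is enlarged to contain the base point z of the indefinite integral.\<close>
  define I where "I = {(p, q) \<in> \<rat> \<times> \<rat>. f integrable_on {min p z..max q z}}"
  have "countable I" unfolding I_def
    by (rule countable_subset[of _ "\<rat> \<times> \<rat>"]) (auto intro: countable_rat)
  define A where "A = (\<Union>(p, q)\<in>I. {u \<in> {min p z<..<max q z}. \<not> ?D u})"
  from \<open>countable I\<close> have 1: "negligible A" unfolding A_def
    using negligible_hk_integral_not_DERIV[of f _ _ z]
    by (intro negligible_countable_Union) (auto simp: I_def)
  have extremal: "negligible S" if "\<And>x y. \<lbrakk>x \<in> S; y \<in> S\<rbrakk> \<Longrightarrow> x \<le> y" for S :: "real set"
  proof -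
    have "\<exists>m. S \<subseteq> {m}" using that by (blast intro: antisym)
    then show ?thesis using negligible_sing negligible_subset by blast
  qed
  have 2: "negligible {u \<in> R. \<forall>v\<in>R. u \<le> v}" "negligible {u \<in> R. \<forall>v\<in>R. v \<le> u}"
    by (rule extremal; simp)+
  have A: "u \<in> A"
    if u: "u \<in> R" "\<not> ?D u" "\<not> (\<forall>v\<in>R. u \<le> v)" "\<not> (\<forall>v\<in>R. v \<le> u)" for u
  proof -
    from u obtain v w where vw: "v \<in> R" "v < u" "w \<in> R" "u < w" by (auto simp: not_le)
    obtain p where p: "p \<in> \<rat>" "v < p" "p < u" using Rats_dense_in_real[OF \<open>v < u\<close>] by auto
    obtain q where q: "q \<in> \<rat>" "u < q" "q < w" using Rats_dense_in_real[OF \<open>u < w\<close>] by auto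
    have "f integrable_on {min v z..max w z}"
      using int z vw by (auto simp: min_def max_def)
    then have "f integrable_on {min p z..max q z}"
      by (rule integrable_subinterval_real) (use p q in auto)
    then have "(p, q) \<in> I" using p q by (simp add: I_def)
    then show ?thesis using p q u unfolding A_def by (intro UN_I[of "(p, q)"]) auto
  qed
  have "negligible (A \<union> ({u \<in> R. \<forall>v\<in>R. u \<le> v} \<union> {u \<in> R. \<forall>v\<in>R. v \<le> u}))"
    by (intro negligible_Un 1 2)
  then show ?thesis
  proof (rule negligible_subset, intro subsetI)
    fix u assume "u \<in> {u \<in> R. \<not> ?D u}"
    then show "u \<in> A \<union> ({u \<in> R. \<forall>v\<in>R. u \<le> v} \<union> {u \<in> R. \<forall>v\<in>R. v \<le> u})"
      using A[of u] by auto
  qed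
qed

section \<open>The substitution formula\<close>

text \<open>
  A nonzero integrand at \<open>x\<close> forces \<open>g' x\<close> to exist and to be nonzero. Failure of the chain rule then
  means that \<open>g x\<close> lies in the null set where \<open>F' = f\<close> fails, and preimages of null sets are null
  on the set where \<open>g'\<close> is nonzero.
\<close>

lemma negligible_chain_rule_fails_at_nonzero_integrand:
  fixes f g :: "real \<Rightarrow> real"
  assumes "a < b"
    and int: "\<forall>s\<in>{a..b}. \<forall>t\<in>{a..b}. g s \<le> g t \<longrightarrow> f integrable_on {g s..g t}"
  shows "negligible {x \<in> {a..b}. \<not> chain_rule_holds_at a b (\<lambda>x. hk_integral (g a) x f) f g x
           \<and> substituted_integrand a b f g x \<noteq> 0}"
proof -
  let ?F = "\<lambda>x. hk_integral (g a) x f"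
  define N where "N = {u \<in> g ` {a..b}. \<not> (?F has_real_derivative f u) (at u)}"
  define g' where "g' x = vector_derivative g (at x within {a..b})" for x
  define S where "S = {x \<in> {a..b}. g differentiable (at x within {a..b}) \<and> g' x \<noteq> 0}"
  have "negligible N" unfolding N_def
    using int \<open>a < b\<close> by (intro negligible_hk_integral_not_DERIV_on) auto
  have g': "(g has_real_derivative g' x) (at x within {a..b})" if "x \<in> S" for x
    using that unfolding S_def g'_def has_real_derivative_iff_has_vector_derivative
    by (simp add: vector_derivative_works[symmetric])
  have null: "negligible {x \<in> S. g x \<in> N}"
  proof (rule negligible_differentiable_vimage[OF \<open>negligible N\<close>])
    fix x assume "x \<in> S"
    then show "inj ((*) (g' x))" by (auto simp: S_def inj_on_def)
    have "(g has_real_derivative g' x) (at x within S)"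
      using g'[OF \<open>x \<in> S\<close>] by (rule DERIV_subset) (auto simp: S_def)
    then show "(g has_derivative (*) (g' x)) (at x within S)"
      by (simp add: has_field_derivative_def)
  qed
  have chain: "chain_rule_holds_at a b ?F f g x" if "x \<in> S" "g x \<notin> N" for x
  proof -
    have "x \<in> {a..b}" using that by (auto simp: S_def)
    then have "(?F has_real_derivative f (g x)) (at (g x))" using that by (auto simp: N_def)
    then have "((?F \<circ> g) has_real_derivative f (g x) * g' x) (at x within {a..b})"
      by (rule DERIV_image_chain[OF has_field_derivative_at_within g'[OF that(1)]])
    then show ?thesis using g'[OF that(1)] unfolding chain_rule_holds_at_def
      by (intro exI[of _ "f (g x) * g' x"] exI[of _ "g' x"]) simp
  qed
  have S: "x \<in> S" if "x \<in> {a..b}" "substituted_integrand a b f g x \<noteq> 0" for x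
    using that by (auto simp: substituted_integrand_def S_def g'_def split: if_splits)
  show ?thesis
  proof (rule negligible_subset[OF null], intro subsetI CollectI conjI)
    fix x assume x: "x \<in> {x \<in> {a..b}. \<not> chain_rule_holds_at a b ?F f g x
        \<and> substituted_integrand a b f g x \<noteq> 0}"
    then show "x \<in> S" using S by simp
    then show "g x \<in> N" using chain x by (metis (no_types, lifting) mem_Collect_eq)
  qed
qed

theorem corollary2:
  fixes a b :: real and f g F :: "real \<Rightarrow> real" and B :: "real set"
  assumes "a < b"
    and "AE x in lebesgue. x \<in> {a..b} \<longrightarrow> g differentiable (at x within {a..b})"
    and "\<forall>s\<in>{a..b}. \<forall>t\<in>{a..b}. g s \<le> g t \<longrightarrow> f integrable_on {g s..g t}"
    and "F = (\<lambda>x. hk_integral (g a) x f)"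
    and "B = {x \<in> {a..b}. \<not> chain_rule_holds_at a b F f g x}"
  shows "(substituted_integrand a b f g integrable_on {a..b} \<and>
          (\<forall>\<alpha> \<beta>. a \<le> \<alpha> \<and> \<alpha> \<le> \<beta> \<and> \<beta> \<le> b \<longrightarrow>
             hk_integral (g \<alpha>) (g \<beta>) f = hk_integral \<alpha> \<beta> (substituted_integrand a b f g)))
         \<longleftrightarrow> negligible_variation_on a b (F \<circ> g) B"
proof -
  let ?h = "substituted_integrand a b f g"
  define k where "k x = (if x \<in> B then 0 else ?h x)" for x
  have "negligible {x \<in> B. ?h x \<noteq> 0}"
    using negligible_chain_rule_fails_at_nonzero_integrand[OF assms(1,3)] by (simp add: assms(4,5))
  then have k: "(k has_integral i) {u..v} \<longleftrightarrow> (?h has_integral i) {u..v}" for i u v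
    by (rule has_integral_spike_eq) (auto simp: k_def)
  \<comment> \<open>Off B the chain rule holds by definition; uniqueness of one-sided derivatives identifies its
    right-hand side with the integrand.\<close>
  have deriv: "((F \<circ> g) has_real_derivative k x) (at x within {a..b})" if "x \<in> {a..b} - B" for x
  proof -
    from that obtain d where d: "((F \<circ> g) has_real_derivative f (g x) * d) (at x within {a..b})"
      "(g has_real_derivative d) (at x within {a..b})"
      by (auto simp: assms(5) chain_rule_holds_at_def)
    then have "vector_derivative g (at x within {a..b}) = d"
      using that \<open>a < b\<close> by (intro vector_derivative_within_closed_interval)
        (auto simp: has_real_derivative_iff_has_vector_derivative)
    moreover have "g differentiable (at x within {a..b})"
      using d(2) real_differentiable_def by blast
    ultimately have "k x = f (g x) * d" using that by (simp add: k_def substituted_integrand_def)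
    with d show ?thesis by simp
  qed
  \<comment> \<open>The three values g a, g u, g v lie in a compact interval whose endpoints are among them, so f
    is integrable there and its integrals can be added.\<close>
  have combine: "hk_integral (g u) (g v) f = (F \<circ> g) v - (F \<circ> g) u" if "u \<in> {a..b}" "v \<in> {a..b}" for u v
  proof -
    define c where "c = Min {g a, g u, g v}"
    define d where "d = Max {g a, g u, g v}"
    have "c \<in> g ` {a, u, v}" "d \<in> g ` {a, u, v}"
      using Min_in[of "{g a, g u, g v}"] Max_in[of "{g a, g u, g v}"] unfolding c_def d_def by auto
    moreover have cd: "{g a, g u, g v} \<subseteq> {c..d}" by (auto simp: c_def d_def)
    moreover have "{a, u, v} \<subseteq> {a..b}" using that \<open>a < b\<close> by auto
    ultimately have "f integrable_on {c..d}" using assms(3) by fastforce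
    then show ?thesis
      using cd by (simp add: assms(4) hk_integral_eq_diff[of f c d])
  qed
  have "negligible_variation_on a b (F \<circ> g) B \<longleftrightarrow>
    (\<forall>u v. a \<le> u \<and> u \<le> v \<and> v \<le> b \<longrightarrow> (?h has_integral (hk_integral (g u) (g v) f)) {u..v})"
    using negligible_variation_iff_indefinite_integral[of a b B "F \<circ> g" k, OF deriv] \<open>a < b\<close>
    by (simp add: k combine) (simp add: k_def)
  also have "\<dots> \<longleftrightarrow> ?h integrable_on {a..b} \<and> (\<forall>\<alpha> \<beta>. a \<le> \<alpha> \<and> \<alpha> \<le> \<beta> \<and> \<beta> \<le> b \<longrightarrow>
             hk_integral (g \<alpha>) (g \<beta>) f = hk_integral \<alpha> \<beta> ?h)"
    (is "?L \<longleftrightarrow> ?R")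
  proof
    assume ?L
    then show ?R using \<open>a < b\<close> by (auto simp: has_integral_iff hk_integral_def)
  next
    assume ?R
    then show ?L
      by (auto simp: has_integral_iff hk_integral_def intro: integrable_subinterval_real)
  qed
  finally show ?thesis by simp
qed

end
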